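(* Let $(G_n)_{n\ge 0}$ be the sequence of graphs defined in the context, and let $T_n(x,y)=T(G_n;x,y)$ be the Tutte polynomial of $G_n$. For every positive integer $n\ge 1$, the Tutte polynomial of $G_n$ along the line $y=x$ is given by $$T_n(x,x)=x\,(x^2+5x+2)^{\frac{4^n-1}{3}}.$$
   Context: Tutte polynomial: for a graph $G$ with vertex set $V(G)$, edge set $E(G)$ and $k(G)$ connected components, put $r(G)=|V(G)|-k(G)$ and $n(G)=|E(G)|-|V(G)|+k(G)$. Then $T(G;x,y)=\sum_{H\subseteq G}(x-1)^{r(G)-r(H)}(y-1)^{n(H)}$, where the sum runs over all spanning subgraphs $H$ of $G$ (subgraphs with $V(H)=V(G)$ and arbitrary $E(H)\subseteq E(G)$). The graphs $G_n$: $G_0$ is the complete graph $K_2$ with its two vertices denoted $X_0,Y_0$. For $n\ge 0$, given $G_n$ with two special vertices $X_n,Y_n$, take four disjoint copies $G_n^1,G_n^2,G_n^3,G_n^4$ of $G_n$, with special vertices $X_n^i,Y_n^i$. Identify $X_n^1$ with $X_n^2$ to form the special vertex $X_{n+1}$ of $G_{n+1}$; identify $Y_n^3$ with $Y_n^4$ to form the special vertex $Y_{n+1}$ of $G_{n+1}$; identify $Y_n^1$ with $X_n^3$ to form a vertex $a$, and $Y_n^2$ with $X_n^4$ to form a vertex $b$; finally add a new edge $e_n$ joining $a$ and $b$. The result is $G_{n+1}$. *)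

theory Defs
  imports Main
begin

text \<open>
  Undirected multigraphs. An edge has its own identity; \<open>ends\<close> gives its set of endpoints
  (a singleton for a loop) and is only meaningful on \<open>edges\<close>.
\<close>

record ('v, 'e) multigraph =
  verts :: "'v set"
  edges :: "'e set"
  ends :: "'e \<Rightarrow> 'v set"

definition adjacent :: "('v, 'e) multigraph \<Rightarrow> ('v \<times> 'v) set" where
  "adjacent G = {(u, v). \<exists>e\<in>edges G. ends G e = {u, v}}"

definition connected_components :: "('v, 'e) multigraph \<Rightarrow> 'v set set" where
  "connected_components G = verts G // {(u, v). u \<in> verts G \<and> v \<in> verts G \<and> (u, v) \<in> (adjacent G)\<^sup>*}"

definition num_components :: "('v, 'e) multigraph \<Rightarrow> nat" where
  "num_components G = card (connected_components G)"

text \<open>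
  For finite graphs \<open>k \<le> |V| \<le> |E| + k\<close>, and rank does not increase when passing to a subgraph,
  so no subtraction on \<open>nat\<close> below truncates.
\<close>

definition graph_rank :: "('v, 'e) multigraph \<Rightarrow> nat" where
  "graph_rank G = card (verts G) - num_components G"

definition graph_nullity :: "('v, 'e) multigraph \<Rightarrow> nat" where
  "graph_nullity G = card (edges G) + num_components G - card (verts G)"

definition spanning_subgraphs :: "('v, 'e) multigraph \<Rightarrow> ('v, 'e) multigraph set" where
  "spanning_subgraphs G = {H. verts H = verts G \<and> edges H \<subseteq> edges G \<and> ends H = ends G}"

text \<open>
  The value of the Tutte polynomial at a point of an arbitrary commutative ring. The polynomial
  itself is the instance in which \<open>x\<close> and \<open>y\<close> are the indeterminates of a polynomial ring.
\<close>

definition tutte :: "('v, 'e) multigraph \<Rightarrow> 'a::comm_ring_1 \<Rightarrow> 'a \<Rightarrow> 'a" where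
  "tutte G x y = (\<Sum>H\<in>spanning_subgraphs G.
     (x - 1) ^ (graph_rank G - graph_rank H) * (y - 1) ^ graph_nullity H)"

text \<open>
  \<open>CopyV i v\<close> and \<open>CopyE i e\<close> are the vertex \<open>v\<close> and the edge \<open>e\<close> in the \<open>i\<close>-th disjoint copy,
  \<open>i = 1, \<dots>, 4\<close>; \<open>NewEdge\<close> is the edge added in the current step.
\<close>

datatype vertex = VX0 | VY0 | CopyV nat vertex

datatype edge = Edge0 | NewEdge | CopyE nat edge

primrec special_X :: "nat \<Rightarrow> vertex" where
  "special_X 0 = VX0"
| "special_X (Suc n) = CopyV 1 (special_X n)"

primrec special_Y :: "nat \<Rightarrow> vertex" where
  "special_Y 0 = VY0"
| "special_Y (Suc n) = CopyV 3 (special_Y n)"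

text \<open>
  Each class of identified vertices is represented by its member in the copy with the smaller index.
  In particular \<open>a\<close> is \<open>CopyV 1 (special_Y n)\<close> and \<open>b\<close> is \<open>CopyV 2 (special_Y n)\<close>.
\<close>

definition identify :: "nat \<Rightarrow> vertex \<Rightarrow> vertex" where
  "identify n v =
    (if v = CopyV 2 (special_X n) then CopyV 1 (special_X n)
     else if v = CopyV 4 (special_Y n) then CopyV 3 (special_Y n)
     else if v = CopyV 3 (special_X n) then CopyV 1 (special_Y n)
     else if v = CopyV 4 (special_X n) then CopyV 2 (special_Y n)
     else v)"

primrec fractal_graph :: "nat \<Rightarrow> (vertex, edge) multigraph" where
  "fractal_graph 0 =
    \<lparr>verts = {special_X 0, special_Y 0}, edges = {Edge0}, ends = (\<lambda>_. {special_X 0, special_Y 0})\<rparr>"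
| "fractal_graph (Suc n) =
    \<lparr>verts = (\<Union>i\<in>{1..4}. (\<lambda>v. identify n (CopyV i v)) ` verts (fractal_graph n)),
     edges = insert NewEdge (\<Union>i\<in>{1..4}. CopyE i ` edges (fractal_graph n)),
     ends = (\<lambda>e. case e of
         CopyE i d \<Rightarrow> (\<lambda>v. identify n (CopyV i v)) ` ends (fractal_graph n) d
       | _ \<Rightarrow> {CopyV 1 (special_Y n), CopyV 2 (special_Y n)})\<rparr>"

end

theory Submission
  imports Defs
begin

text \<open>
  Classify the edge sets of \<open>G\<^sub>n\<close> by whether they join the special vertices. The claim is that on
  the line \<open>y = x\<close>, with \<open>z = x - 1\<close>, the joining sets contribute \<open>(z\<^sup>2 + 7 z + 8)\<^sup>N\<close>
  with \<open>N = (4\<^sup>n - 1) / 3\<close>, and the other ones exactly \<open>z\<close> times as much. An edge set of the next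
  graph consists of four edge sets of \<open>G\<^sub>n\<close>, each acting as a present or absent edge of the graph
  with vertices \<open>X, Y, a, b\<close> and edges \<open>Xa, Xb, aY, bY, ab\<close>, and a choice of \<open>ab\<close>. Since the
  present and absent states have proportional weights, each step multiplies the fourth power of the
  common factor by the corresponding sum for this bridge graph, which is again
  \<open>z\<^sup>2 + 7 z + 8 = x\<^sup>2 + 5 x + 2\<close> in both classes. Components are counted by a labelling that is
  updated as pairs of vertices are identified.
\<close>

declare One_nat_def [simp del]

section \<open>Components counted by labellings\<close>

text \<open>The kernel of \<open>f\<close> is the closure of \<open>R\<close>, so connectivity
  becomes equality of labels, which simplification can decide.\<close>

definition labels :: "('v \<times> 'v) set \<Rightarrow> ('v \<Rightarrow> 'l) \<Rightarrow> bool" where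
  "labels R f \<longleftrightarrow> (\<forall>x y. (x, y) \<in> R\<^sup>* \<longleftrightarrow> f x = f y)"

text \<open>The union step of a union-find structure: the class of \<open>v\<close> takes over the
  label of \<open>u\<close>.\<close>

definition merge :: "('v \<Rightarrow> 'l) \<Rightarrow> 'v \<Rightarrow> 'v \<Rightarrow> 'v \<Rightarrow> 'l" where
  "merge f u v = (\<lambda>x. if f x = f v then f u else f x)"

lemma card_image_eqI:
  assumes "\<And>u v. u \<in> V \<Longrightarrow> v \<in> V \<Longrightarrow> f u = f v \<longleftrightarrow> g u = g v"
  shows "card (f ` V) = card (g ` V)"
proof -
  have *: "f (inv_into V g (g u)) = f u" "inv_into V g (g u) \<in> V" if "u \<in> V" for u
    using assms[of "inv_into V g (g u)" u] that by (auto simp: f_inv_into_f inv_into_into)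
  have "bij_betw (\<lambda>y. f (inv_into V g y)) (g ` V) (f ` V)"
  proof (rule bij_betw_imageI)
    show "inj_on (\<lambda>y. f (inv_into V g y)) (g ` V)"
      using * assms by (auto simp: inj_on_def)
    show "(\<lambda>y. f (inv_into V g y)) ` g ` V = f ` V"
      by (simp add: image_image *(1) cong: image_cong)
  qed
  then show ?thesis
    by (simp add: bij_betw_same_card)
qed

text \<open>Equivalence classes correspond to values of \<open>f\<close>. The hypothesis is confined
  to \<open>verts G\<close>, so a labelling made for the vertices before gluing also serves the
  glued graph.\<close>

lemma num_components_eq_card_image:
  assumes "\<And>u v. u \<in> verts G \<Longrightarrow> v \<in> verts G \<Longrightarrow> (u, v) \<in> (adjacent G)\<^sup>* \<longleftrightarrow> f u = f v"
  shows "num_components G = card (f ` verts G)"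
proof -
  let ?r = "{(u, v). u \<in> verts G \<and> v \<in> verts G \<and> (u, v) \<in> (adjacent G)\<^sup>*}"
  have "verts G // ?r = (\<lambda>v. ?r `` {v}) ` verts G"
    by (auto simp: quotient_def)
  moreover have "card ((\<lambda>v. ?r `` {v}) ` verts G) = card (f ` verts G)"
    by (rule card_image_eqI) (use assms in \<open>auto simp: set_eq_iff\<close>)
  ultimately show ?thesis
    by (simp add: num_components_def connected_components_def)
qed

lemma labels_Image:
  assumes "sym R"
  shows "labels R (\<lambda>x. R\<^sup>* `` {x})"
  unfolding labels_def using sym_rtrancl[OF assms]
  by (auto simp: set_eq_iff dest: symD intro: rtrancl_trans)

text \<open>If two merged labels agree, either the old ones did, or one vertex lies in the class of
  \<open>u\<close> and the other in that of \<open>v\<close>, and the new pair connects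
  them.\<close>

lemma labels_merge:
  assumes "labels R f"
  shows "labels (insert (u, v) (insert (v, u) R)) (merge f u v)" (is "labels ?S ?g")
  unfolding labels_def
proof (intro allI iffI)
  fix x y
  have R: "(a, b) \<in> ?S\<^sup>*" if "f a = f b" for a b
    using assms that rtrancl_mono[of R ?S] unfolding labels_def by blast
  have uv: "(u, v) \<in> ?S\<^sup>*" "(v, u) \<in> ?S\<^sup>*" by auto
  show "?g x = ?g y" if "(x, y) \<in> ?S\<^sup>*"
    using that
  proof induction
    case (step y z)
    have "f y = f z" if "(y, z) \<in> R"
      using assms that unfolding labels_def by blast
    with step show ?case
      by (auto simp: merge_def)
  qed simp
  show "(x, y) \<in> ?S\<^sup>*" if "?g x = ?g y"
  proof -
    have "(x, y) \<in> ?S\<^sup>*" if "f x = f v" "f u = f y"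
      using R[of x v] R[of u y] uv that by (meson rtrancl_trans)
    moreover have "(x, y) \<in> ?S\<^sup>*" if "f x = f u" "f v = f y"
      using R[of x u] R[of v y] uv that by (meson rtrancl_trans)
    ultimately show ?thesis
      using that R[of x y] by (auto simp: merge_def split: if_splits)
  qed
qed

lemma card_merge:
  assumes "finite D" "u \<in> D" "v \<in> D"
  shows "card (merge f u v ` D) + of_bool (f u \<noteq> f v) = card (f ` D)"
proof (cases "f u = f v")
  case True
  then have "merge f u v = f" by (auto simp: merge_def)
  with True show ?thesis by simp
next
  case False
  then have "merge f u v ` D = f ` D - {f v}"
    using assms by (auto simp: merge_def)
  moreover have "card (f ` D) > 0"
    using assms by (auto simp: card_gt_0_iff)
  ultimately show ?thesis using False assms by simp
qed

section \<open>Edge sets of the graphs and adjacency after one step\<close>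

abbreviation subgraph :: "nat \<Rightarrow> edge set \<Rightarrow> (vertex, edge) multigraph" where
  "subgraph n A \<equiv> (fractal_graph n)\<lparr>edges := A\<rparr>"

definition joined :: "nat \<Rightarrow> edge set \<Rightarrow> bool" where
  "joined n A \<longleftrightarrow> (special_X n, special_Y n) \<in> (adjacent (subgraph n A))\<^sup>*"

definition comps :: "nat \<Rightarrow> edge set \<Rightarrow> nat" where
  "comps n A = num_components (subgraph n A)"

abbreviation part :: "nat \<Rightarrow> edge set \<Rightarrow> edge set" where
  "part i A \<equiv> CopyE i -` A"

lemma special_X_neq_Y: "special_X n \<noteq> special_Y n"
  by (cases n) auto

lemma finite_verts: "finite (verts (fractal_graph n))"
  by (induction n) auto

lemma finite_edges: "finite (edges (fractal_graph n))"
  by (induction n) auto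

lemma copies: "{1..4} = {1, 2, 3, 4::nat}"
  by auto

lemma special_in_verts: "special_X n \<in> verts (fractal_graph n)" "special_Y n \<in> verts (fractal_graph n)"
proof (induction n)
  case (Suc n)
  { case 1
    have "special_X (Suc n) = identify n (CopyV 1 (special_X n))"
      by (simp add: identify_def special_X_neq_Y)
    with Suc show ?case
      by (auto simp: copies simp del: special_X.simps) }
  { case 2
    have "special_Y (Suc n) = identify n (CopyV 3 (special_Y n))"
      using special_X_neq_Y[of n] by (simp add: identify_def)
    with Suc show ?case
      by (auto simp: copies simp del: special_Y.simps) }
qed simp_all

text \<open>Needed to pull an adjacency of the next graph back to a copy: it supplies the two
  endpoints before identification.\<close>

lemma ends_eq_doubleton:
  "e \<in> edges (fractal_graph n) \<Longrightarrow> \<exists>u v. ends (fractal_graph n) e = {u, v}"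
proof (induction n arbitrary: e)
  case (Suc n)
  from Suc.prems consider "e = NewEdge" | i d where "e = CopyE i d" "d \<in> edges (fractal_graph n)"
    by auto
  then show ?case
  proof cases
    case 2
    with Suc.IH[of d] show ?thesis by fastforce
  qed auto
qed auto

lemma adjacent_subgraph_Suc:
  assumes "A \<subseteq> edges (fractal_graph (Suc n))"
  shows "adjacent (subgraph (Suc n) A) =
    (\<Union>i\<in>{1..4}. (\<lambda>(u, v). (identify n (CopyV i u), identify n (CopyV i v))) `
       adjacent (subgraph n (part i A))) \<union>
    (if NewEdge \<in> A then {(CopyV 1 (special_Y n), CopyV 2 (special_Y n)),
       (CopyV 2 (special_Y n), CopyV 1 (special_Y n))} else {})" (is "?L = ?R")
proof
  show "?L \<subseteq> ?R"
  proof
    fix p assume "p \<in> ?L"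
    moreover obtain u v where p: "p = (u, v)" by fastforce
    ultimately obtain e where e: "e \<in> A" "ends (fractal_graph (Suc n)) e = {u, v}"
      by (auto simp: adjacent_def)
    from e assms consider "e = NewEdge"
      | i d where "i \<in> {1..4}" "e = CopyE i d" "d \<in> edges (fractal_graph n)"
      by auto
    then show "p \<in> ?R"
    proof cases
      case 1
      with e p show ?thesis by (auto simp: doubleton_eq_iff)
    next
      case 2
      obtain s t where st: "ends (fractal_graph n) d = {s, t}"
        using ends_eq_doubleton[OF 2(3)] by auto
      with e 2 have "{identify n (CopyV i s), identify n (CopyV i t)} = {u, v}" by simp
      moreover have "(s, t) \<in> adjacent (subgraph n (part i A))" "(t, s) \<in> adjacent (subgraph n (part i A))"
        using st e 2 by (auto simp: adjacent_def)
      ultimately have "p \<in> (\<lambda>(u, v). (identify n (CopyV i u), identify n (CopyV i v))) `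
       adjacent (subgraph n (part i A))"
        unfolding p by (force simp: doubleton_eq_iff)
      with 2(1) show ?thesis by blast
    qed
  qed
  have "(identify n (CopyV i u), identify n (CopyV i v)) \<in> ?L"
    if uv: "(u, v) \<in> adjacent (subgraph n (part i A))" for i u v
  proof -
    obtain d where "CopyE i d \<in> A" "ends (fractal_graph n) d = {u, v}"
      using uv by (auto simp: adjacent_def)
    then show ?thesis
      by (auto simp: adjacent_def intro!: bexI[of _ "CopyE i d"])
  qed
  moreover have "(CopyV 1 (special_Y n), CopyV 2 (special_Y n)) \<in> ?L"
    "(CopyV 2 (special_Y n), CopyV 1 (special_Y n)) \<in> ?L" if "NewEdge \<in> A"
    using that by (auto simp: adjacent_def intro!: bexI[of _ NewEdge])
  ultimately show "?R \<subseteq> ?L"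
    by (auto simp del: fractal_graph.simps split: if_splits)
qed

lemma sym_adjacent: "sym (adjacent G)"
  by (auto simp: adjacent_def sym_def insert_commute)

section \<open>Identification replaced by added pairs\<close>

definition copies_rel :: "(nat \<Rightarrow> vertex rel) \<Rightarrow> vertex rel" where
  "copies_rel R = (\<Union>i\<in>{1..4}. map_prod (CopyV i) (CopyV i) ` R i)"

abbreviation add_pair :: "'v \<Rightarrow> 'v \<Rightarrow> 'v rel \<Rightarrow> 'v rel" where
  "add_pair u v R \<equiv> insert (u, v) (insert (v, u) R)"

text \<open>Instead of being replaced by representatives, identified vertices stay distinct and are
  linked by pairs. The nesting makes each pair a single application of
  \<open>labels_merge\<close>.\<close>

definition glue_rel :: "nat \<Rightarrow> vertex rel \<Rightarrow> vertex rel" where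
  "glue_rel n R =
     add_pair (CopyV 4 (special_X n)) (CopyV 2 (special_Y n))
      (add_pair (CopyV 3 (special_X n)) (CopyV 1 (special_Y n))
       (add_pair (CopyV 4 (special_Y n)) (CopyV 3 (special_Y n))
        (add_pair (CopyV 2 (special_X n)) (CopyV 1 (special_X n)) R)))"

definition bridge_rel :: "nat \<Rightarrow> bool \<Rightarrow> vertex rel \<Rightarrow> vertex rel" where
  "bridge_rel n e R =
     (if e then add_pair (CopyV 1 (special_Y n)) (CopyV 2 (special_Y n)) R else R)"

text \<open>The copies are disjoint before gluing, so a path never leaves the copy in which it
  starts.\<close>

lemma CopyV_rtrancl_copies_rel:
  assumes "i \<in> {1..4}"
  shows "(CopyV i u, y) \<in> (copies_rel R)\<^sup>* \<longleftrightarrow> (\<exists>v. y = CopyV i v \<and> (u, v) \<in> (R i)\<^sup>*)"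
proof
  show "\<exists>v. y = CopyV i v \<and> (u, v) \<in> (R i)\<^sup>*" if "(CopyV i u, y) \<in> (copies_rel R)\<^sup>*"
    using that by induction (auto simp: copies_rel_def intro: rtrancl.rtrancl_into_rtrancl)
  have "(CopyV i u, CopyV i v) \<in> (copies_rel R)\<^sup>*" if "(u, v) \<in> (R i)\<^sup>*" for v
    using that
  proof induction
    case (step y z)
    with assms have "(CopyV i y, CopyV i z) \<in> copies_rel R"
      by (force simp: copies_rel_def)
    with step show ?case by (meson rtrancl.rtrancl_into_rtrancl)
  qed simp
  then show "(CopyV i u, y) \<in> (copies_rel R)\<^sup>*" if "\<exists>v. y = CopyV i v \<and> (u, v) \<in> (R i)\<^sup>*"
    using that by auto
qed

lemma sym_copies_rel: "(\<And>i. sym (R i)) \<Longrightarrow> sym (copies_rel R)"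
  by (fastforce simp: copies_rel_def sym_def)

lemma rtrancl_glue_rel_identify:
  "(x, identify n x) \<in> (glue_rel n R)\<^sup>*" "(identify n x, x) \<in> (glue_rel n R)\<^sup>*"
  by (auto simp: identify_def glue_rel_def intro!: r_into_rtrancl)

lemma rtrancl_bridge_rel_mono: "R\<^sup>* \<subseteq> (bridge_rel n e R)\<^sup>*"
  by (rule rtrancl_mono) (auto simp: bridge_rel_def)

lemma identify_glue:
  "identify n (CopyV 1 v) = CopyV 1 v"
  "identify n (CopyV 2 (special_Y n)) = CopyV 2 (special_Y n)"
  "identify n (CopyV 2 (special_X n)) = CopyV 1 (special_X n)"
  "identify n (CopyV 4 (special_Y n)) = CopyV 3 (special_Y n)"
  "identify n (CopyV 3 (special_Y n)) = CopyV 3 (special_Y n)"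
  "identify n (CopyV 3 (special_X n)) = CopyV 1 (special_Y n)"
  "identify n (CopyV 4 (special_X n)) = CopyV 2 (special_Y n)"
  using special_X_neq_Y[of n] by (auto simp: identify_def)

lemma identify_idem: "identify n (identify n v) = identify n v"
  unfolding identify_def[of n v] by (simp add: identify_glue) (simp add: identify_def)

definition split_rel :: "nat \<Rightarrow> edge set \<Rightarrow> vertex rel" where
  "split_rel n A = bridge_rel n (NewEdge \<in> A)
     (glue_rel n (copies_rel (\<lambda>i. adjacent (subgraph n (part i A)))))"

text \<open>Each edge of the glued graph lifts to a path that uses gluing pairs. Conversely,
  \<open>identify\<close> sends each pair of \<open>split_rel\<close> to an edge or to two equal
  vertices, and it fixes the vertices of the glued graph.\<close>

lemma rtrancl_adjacent_Suc:
  assumes A: "A \<subseteq> edges (fractal_graph (Suc n))"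
    and "u \<in> verts (fractal_graph (Suc n))" "v \<in> verts (fractal_graph (Suc n))"
  shows "(u, v) \<in> (adjacent (subgraph (Suc n) A))\<^sup>* \<longleftrightarrow> (u, v) \<in> (split_rel n A)\<^sup>*"
proof
  let ?R = "copies_rel (\<lambda>i. adjacent (subgraph n (part i A)))"
  let ?S = "split_rel n A"
  have id: "(x, identify n x) \<in> ?S\<^sup>*" "(identify n x, x) \<in> ?S\<^sup>*" for x
    using rtrancl_glue_rel_identify rtrancl_bridge_rel_mono unfolding split_rel_def by blast+
  have "?R \<subseteq> ?S"
    by (auto simp: split_rel_def bridge_rel_def glue_rel_def)
  have "adjacent (subgraph (Suc n) A) \<subseteq> ?S\<^sup>*"
  proof -
    have "(identify n (CopyV i s), identify n (CopyV i t)) \<in> ?S\<^sup>*"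
      if "i \<in> {1..4}" "(s, t) \<in> adjacent (subgraph n (part i A))" for i s t
    proof -
      have "(CopyV i s, CopyV i t) \<in> ?R"
        using that by (force simp: copies_rel_def)
      with \<open>?R \<subseteq> ?S\<close> id show ?thesis
        by (meson r_into_rtrancl rtrancl_trans subsetD)
    qed
    moreover have "(CopyV 1 (special_Y n), CopyV 2 (special_Y n)) \<in> ?S"
      "(CopyV 2 (special_Y n), CopyV 1 (special_Y n)) \<in> ?S" if "NewEdge \<in> A"
      using that by (auto simp: split_rel_def bridge_rel_def)
    ultimately show ?thesis
      unfolding adjacent_subgraph_Suc[OF A] by (auto split: if_splits)
  qed
  then show "(u, v) \<in> ?S\<^sup>*" if "(u, v) \<in> (adjacent (subgraph (Suc n) A))\<^sup>*"
    using that rtrancl_subset_rtrancl by blast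
  have edge: "(identify n x, identify n y) \<in> (adjacent (subgraph (Suc n) A))\<^sup>*" if "(x, y) \<in> ?S" for x y
  proof -
    consider (copy) "(x, y) \<in> ?R"
      | (new) "NewEdge \<in> A" "(x, y) \<in> {(CopyV 1 (special_Y n), CopyV 2 (special_Y n)),
          (CopyV 2 (special_Y n), CopyV 1 (special_Y n))}"
      | (ident) "identify n x = identify n y"
      using \<open>(x, y) \<in> ?S\<close>
      by (auto simp: split_rel_def bridge_rel_def glue_rel_def identify_glue split: if_splits)
    then show ?thesis
    proof cases
      case copy
      then show ?thesis
        unfolding adjacent_subgraph_Suc[OF A] copies_rel_def by (intro r_into_rtrancl) force
    next
      case new
      then show ?thesis
        unfolding adjacent_subgraph_Suc[OF A] by (intro r_into_rtrancl) (auto simp: identify_glue)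
    qed simp
  qed
  have "(identify n x, identify n y) \<in> (adjacent (subgraph (Suc n) A))\<^sup>*" if "(x, y) \<in> ?S\<^sup>*" for x y
    using that
  proof induction
    case (step y z)
    show ?case by (rule rtrancl_trans[OF step.IH edge[OF step.hyps(2)]])
  qed simp
  moreover have "identify n w = w" if "w \<in> verts (fractal_graph (Suc n))" for w
    using that by (auto simp: identify_idem)
  ultimately show "(u, v) \<in> (adjacent (subgraph (Suc n) A))\<^sup>*" if "(u, v) \<in> ?S\<^sup>*"
    using that assms by metis
qed

section \<open>Components of the glued graph\<close>

text \<open>
  \<open>c1, c2, c3, c4, e\<close> tell which of the edges \<open>Xa, Xb, aY, bY, ab\<close> of the bridge graph are present.
\<close>

definition bridge_joined :: "bool \<Rightarrow> bool \<Rightarrow> bool \<Rightarrow> bool \<Rightarrow> bool \<Rightarrow> bool" where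
  "bridge_joined c1 c2 c3 c4 e \<longleftrightarrow>
     c1 \<and> c3 \<or> c2 \<and> c4 \<or> e \<and> (c1 \<and> c4 \<or> c2 \<and> c3)"

text \<open>The cyclomatic number of the chosen subgraph: with \<open>ab\<close> the two triangles
  are independent, without it only the square through \<open>X, a, Y, b\<close> can close.\<close>

definition bridge_cycles :: "bool \<Rightarrow> bool \<Rightarrow> bool \<Rightarrow> bool \<Rightarrow> bool \<Rightarrow> nat" where
  "bridge_cycles c1 c2 c3 c4 e =
     (if e then of_bool (c1 \<and> c2) + of_bool (c3 \<and> c4) else of_bool (c1 \<and> c2 \<and> c3 \<and> c4))"

text \<open>Starting from four disjoint copies, the four identifications and possibly the edge
  \<open>ab\<close> are performed one by one. Each lowers the number of components by one unless its
  two vertices are already connected, which happens once per independent cycle of the bridge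
  graph.\<close>

lemma comps_joined_Suc:
  assumes A: "A \<subseteq> edges (fractal_graph (Suc n))"
  defines "c \<equiv> \<lambda>i. joined n (part i A)"
  shows "joined (Suc n) A \<longleftrightarrow> bridge_joined (c 1) (c 2) (c 3) (c 4) (NewEdge \<in> A)" (is ?J)
    and "comps (Suc n) A + 4 + of_bool (NewEdge \<in> A) =
      (\<Sum>i\<in>{1..4}. comps n (part i A)) + bridge_cycles (c 1) (c 2) (c 3) (c 4) (NewEdge \<in> A)" (is ?C)
proof -
  let ?V = "verts (fractal_graph n)"
  define D where "D = (\<Union>i\<in>{1..4}. CopyV i ` ?V)"
  define R where "R = copies_rel (\<lambda>i. adjacent (subgraph n (part i A)))"
  \<comment> \<open>\<open>f0\<close> labels the disjoint copies, \<open>f1\<close> to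
    \<open>f4\<close> perform the identifications of \<open>glue_rel\<close> from the inside out,
    and \<open>f5\<close> accounts for \<open>ab\<close>.\<close>
  define f0 where "f0 = (\<lambda>x. R\<^sup>* `` {x})"
  define X Y where "X = (\<lambda>i. CopyV i (special_X n))" and "Y = (\<lambda>i. CopyV i (special_Y n))"
  define f1 where "f1 = merge f0 (X 2) (X 1)"
  define f2 where "f2 = merge f1 (Y 4) (Y 3)"
  define f3 where "f3 = merge f2 (X 3) (Y 1)"
  define f4 where "f4 = merge f3 (X 4) (Y 2)"
  define f5 where "f5 = (if NewEdge \<in> A then merge f4 (Y 1) (Y 2) else f4)"
  have f0: "labels R f0"
    unfolding f0_def R_def by (intro labels_Image sym_copies_rel sym_adjacent)
  have f5: "labels (split_rel n A) f5"
    using f0 unfolding f5_def f4_def f3_def f2_def f1_def X_def Y_def R_def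
      split_rel_def bridge_rel_def glue_rel_def
    by (simp add: labels_merge)
  have f0_eq: "f0 (CopyV i u) = f0 (CopyV j v) \<longleftrightarrow> i = j \<and> (u, v) \<in> (adjacent (subgraph n (part i A)))\<^sup>*"
    if "i \<in> {1..4}" "j \<in> {1..4}" for i j u v
  proof -
    have "f0 (CopyV i u) = f0 (CopyV j v) \<longleftrightarrow> (CopyV i u, CopyV j v) \<in> R\<^sup>*"
      using f0 by (simp add: labels_def)
    with that show ?thesis
      by (auto simp: R_def CopyV_rtrancl_copies_rel)
  qed
  have D: "finite D" "i \<in> {1..4} \<Longrightarrow> X i \<in> D" "i \<in> {1..4} \<Longrightarrow> Y i \<in> D" for i
    using finite_verts special_in_verts by (auto simp: D_def X_def Y_def intro!: bexI[of _ i])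
  have "card (f0 ` D) = (\<Sum>i\<in>{1..4}. card (f0 ` CopyV i ` ?V))"
    unfolding D_def image_UN using finite_verts f0_eq
    by (intro card_UN_disjoint) auto
  also have "\<dots> = (\<Sum>i\<in>{1..4}. comps n (part i A))"
  proof (intro sum.cong refl)
    fix i :: nat assume "i \<in> {1..4}"
    then show "card (f0 ` CopyV i ` ?V) = comps n (part i A)"
      unfolding comps_def
      by (subst num_components_eq_card_image[of _ "\<lambda>v. f0 (CopyV i v)"]) (auto simp: f0_eq image_image)
  qed
  finally have card0: "card (f0 ` D) = (\<Sum>i\<in>{1..4}. comps n (part i A))" .
  have "verts (fractal_graph (Suc n)) = identify n ` D"
    by (auto simp: D_def)
  \<comment> \<open>Invariance under \<open>identify\<close> lets the components be counted on the
    unglued set \<open>D\<close>.\<close>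
  moreover have "f5 (identify n v) = f5 v" for v
    using f5 rtrancl_glue_rel_identify rtrancl_bridge_rel_mono
    unfolding labels_def split_rel_def by blast
  ultimately have card5: "comps (Suc n) A = card (f5 ` D)"
    using f5 rtrancl_adjacent_Suc[OF A] unfolding comps_def labels_def
    by (subst num_components_eq_card_image[of _ f5]) (auto simp: image_image)
  have joined5: "joined (Suc n) A \<longleftrightarrow> f5 (X 1) = f5 (Y 3)"
    using f5 rtrancl_adjacent_Suc[OF A special_in_verts]
    unfolding joined_def labels_def by (simp add: X_def Y_def)
  have cards: "card (f1 ` D) + of_bool (f0 (X 2) \<noteq> f0 (X 1)) = card (f0 ` D)"
    "card (f2 ` D) + of_bool (f1 (Y 4) \<noteq> f1 (Y 3)) = card (f1 ` D)"
    "card (f3 ` D) + of_bool (f2 (X 3) \<noteq> f2 (Y 1)) = card (f2 ` D)"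
    "card (f4 ` D) + of_bool (f3 (X 4) \<noteq> f3 (Y 2)) = card (f3 ` D)"
    "card (f5 ` D) + of_bool (NewEdge \<in> A \<and> f4 (Y 1) \<noteq> f4 (Y 2)) = card (f4 ` D)"
    unfolding f1_def f2_def f3_def f4_def
       apply (rule card_merge; simp add: D)+
    using card_merge[OF D(1), of "Y 1" "Y 2" f4] D
    by (simp add: f5_def f1_def f2_def f3_def f4_def)
  \<comment> \<open>Every equality between initial labels of special vertices reduces to the states
    \<open>c i\<close>; both claims are then finite case checks.\<close>
  have XY: "f0 (X i) = f0 (X j) \<longleftrightarrow> i = j" "f0 (Y i) = f0 (Y j) \<longleftrightarrow> i = j"
     "f0 (X i) = f0 (Y j) \<longleftrightarrow> i = j \<and> c i" "f0 (Y j) = f0 (X i) \<longleftrightarrow> i = j \<and> c i"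
    if "i \<in> {1..4}" "j \<in> {1..4}" for i j
    using that f0_eq eq_commute[of "f0 (Y j)"] unfolding X_def Y_def c_def joined_def by auto
  show ?J
    unfolding joined5 bridge_joined_def f5_def f4_def f3_def f2_def f1_def merge_def
    by (cases "c 1"; cases "c 2"; cases "c 3"; cases "c 4") (simp_all add: XY)
  have "of_bool (f0 (X 2) \<noteq> f0 (X 1)) + of_bool (f1 (Y 4) \<noteq> f1 (Y 3)) +
      of_bool (f2 (X 3) \<noteq> f2 (Y 1)) + of_bool (f3 (X 4) \<noteq> f3 (Y 2)) +
      of_bool (NewEdge \<in> A \<and> f4 (Y 1) \<noteq> f4 (Y 2)) +
      bridge_cycles (c 1) (c 2) (c 3) (c 4) (NewEdge \<in> A) = 4 + of_bool (NewEdge \<in> A)"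
    unfolding bridge_cycles_def f4_def f3_def f2_def f1_def merge_def
    by (cases "c 1"; cases "c 2"; cases "c 3"; cases "c 4"; cases "NewEdge \<in> A") (simp_all add: XY)
  with cards show ?C
    unfolding card0[symmetric] card5 by linarith
qed

lemma comps_empty: "comps n {} = card (verts (fractal_graph n))"
  and not_joined_empty: "\<not> joined n {}"
proof -
  have [simp]: "adjacent (subgraph n {}) = {}"
    by (simp add: adjacent_def)
  show "\<not> joined n {}"
    by (simp add: joined_def special_X_neq_Y)
  show "comps n {} = card (verts (fractal_graph n))"
    unfolding comps_def by (subst num_components_eq_card_image[of _ id]) auto
qed

text \<open>The edgeless spanning subgraph counts the vertices.\<close>

lemma card_verts_Suc: "card (verts (fractal_graph (Suc n))) + 4 = 4 * card (verts (fractal_graph n))"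
  using comps_joined_Suc(2)[of "{}" n]
  by (simp add: comps_empty not_joined_empty bridge_cycles_def del: fractal_graph.simps)

section \<open>Splitting an edge set into four parts and the new edge\<close>

definition glue :: "edge set \<Rightarrow> edge set \<Rightarrow> edge set \<Rightarrow> edge set \<Rightarrow> bool \<Rightarrow> edge set" where
  "glue A1 A2 A3 A4 e =
     (if e then {NewEdge} else {}) \<union> CopyE 1 ` A1 \<union> CopyE 2 ` A2 \<union> CopyE 3 ` A3 \<union> CopyE 4 ` A4"

lemma part_glue:
  "part 1 (glue A1 A2 A3 A4 e) = A1" "part 2 (glue A1 A2 A3 A4 e) = A2"
  "part 3 (glue A1 A2 A3 A4 e) = A3" "part 4 (glue A1 A2 A3 A4 e) = A4"
  "NewEdge \<in> glue A1 A2 A3 A4 e \<longleftrightarrow> e"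
  by (auto simp: glue_def)

lemma CopyE_mem_glue:
  "CopyE i d \<in> glue A1 A2 A3 A4 e \<longleftrightarrow>
     i = 1 \<and> d \<in> A1 \<or> i = 2 \<and> d \<in> A2 \<or> i = 3 \<and> d \<in> A3 \<or> i = 4 \<and> d \<in> A4"
  by (auto simp: glue_def)

text \<open>The next graph has neither \<open>Edge0\<close> nor a copy index outside 1 to 4, so the
  parts lose nothing of \<open>A\<close>.\<close>

lemma glue_parts:
  assumes "A \<subseteq> edges (fractal_graph (Suc n))"
  shows "glue (part 1 A) (part 2 A) (part 3 A) (part 4 A) (NewEdge \<in> A) = A"
proof (rule set_eqI)
  fix x
  show "x \<in> glue (part 1 A) (part 2 A) (part 3 A) (part 4 A) (NewEdge \<in> A) \<longleftrightarrow> x \<in> A"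
  proof (cases x)
    case Edge0
    then show ?thesis
      using assms by (auto simp: glue_def)
  next
    case NewEdge
    then show ?thesis by (simp add: part_glue)
  next
    case (CopyE i d)
    have "i \<in> {1, 2, 3, 4}" if "CopyE i d \<in> A"
      using subsetD[OF assms that] by (auto simp: copies)
    then show ?thesis
      unfolding CopyE CopyE_mem_glue by auto
  qed
qed

lemma part_subset:
  "A \<subseteq> edges (fractal_graph (Suc n)) \<Longrightarrow> part i A \<subseteq> edges (fractal_graph n)"
  by auto

lemma glue_subset:
  assumes "A1 \<subseteq> edges (fractal_graph n)" "A2 \<subseteq> edges (fractal_graph n)"
    "A3 \<subseteq> edges (fractal_graph n)" "A4 \<subseteq> edges (fractal_graph n)"
  shows "glue A1 A2 A3 A4 e \<subseteq> edges (fractal_graph (Suc n))"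
  using assms by (auto simp: glue_def copies)

lemma card_glue:
  assumes "finite A1" "finite A2" "finite A3" "finite A4"
  shows "card (glue A1 A2 A3 A4 e) = of_bool e + card A1 + card A2 + card A3 + card A4"
proof -
  have *: "card (CopyE i ` A) = card A" for i A
    by (simp add: card_image inj_on_def)
  have disj: "CopyE i ` A \<inter> CopyE j ` B = {}" if "i \<noteq> j" for i j A B
    using that by auto
  have new: "insert NewEdge {} \<inter> CopyE i ` A = {}" for i A
    by auto
  show ?thesis
    unfolding glue_def using assms
    by (simp add: card_Un_disjoint disj new * Int_Un_distrib2)
qed

text \<open>\<open>glue\<close> and the parts are mutually inverse. Nested sums, rather than one
  over a product, let the induction treat one copy at a time.\<close>

lemma sum_Pow_edges_Suc:
  fixes F :: "edge set \<Rightarrow> 'a::comm_monoid_add" and n :: nat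
  defines "P \<equiv> Pow (edges (fractal_graph n))"
  shows "(\<Sum>A\<in>Pow (edges (fractal_graph (Suc n))). F A) =
    (\<Sum>A1\<in>P. \<Sum>A2\<in>P. \<Sum>A3\<in>P. \<Sum>A4\<in>P. \<Sum>e\<in>UNIV. F (glue A1 A2 A3 A4 e))"
proof -
  have "(\<Sum>A\<in>Pow (edges (fractal_graph (Suc n))). F A) =
     (\<Sum>(A1, A2, A3, A4, e)\<in>P \<times> P \<times> P \<times> P \<times> UNIV. F (glue A1 A2 A3 A4 e))"
    unfolding P_def
  proof (rule sum.reindex_bij_witness[where j = "\<lambda>A. (part 1 A, part 2 A, part 3 A, part 4 A, NewEdge \<in> A)"
          and i = "\<lambda>(A1, A2, A3, A4, e). glue A1 A2 A3 A4 e"], goal_cases)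
    case (1 A)
    then show ?case by (simp add: glue_parts del: fractal_graph.simps)
  next
    case (2 A)
    then show ?case using part_subset[of A n] by (simp del: fractal_graph.simps)
  next
    case (3 B)
    show ?case by (simp add: part_glue split: prod.split)
  next
    case (4 B)
    then show ?case by (cases B) (simp add: glue_subset del: fractal_graph.simps)
  next
    case (5 A)
    then show ?case by (simp add: glue_parts del: fractal_graph.simps)
  qed
  then show ?thesis
    by (simp add: sum.cartesian_product)
qed

section \<open>Exponents and their additivity\<close>

text \<open>The number of components that contain a special vertex.\<close>

definition terminal_comps :: "bool \<Rightarrow> nat" where
  "terminal_comps c = (if c then 1 else 2)"

text \<open>
  The exponent of \<open>z\<close>, reduced by one if the special vertices are not joined.
\<close>

definition weight :: "nat \<Rightarrow> edge set \<Rightarrow> nat" where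
  "weight n A = (comps n A - terminal_comps (joined n A)) +
     (card A + comps n A - card (verts (fractal_graph n)))"

text \<open>The analogue of \<open>weight\<close> for the bridge graph itself, which has four
  vertices and, with \<open>m\<close> edges present, \<open>4 - m + bridge_cycles\<close>
  components.\<close>

definition bridge_weight :: "bool \<Rightarrow> bool \<Rightarrow> bool \<Rightarrow> bool \<Rightarrow> bool \<Rightarrow> nat" where
  "bridge_weight c1 c2 c3 c4 e =
     4 + 2 * bridge_cycles c1 c2 c3 c4 e
       - (of_bool c1 + of_bool c2 + of_bool c3 + of_bool c4 + of_bool e)
       - terminal_comps (bridge_joined c1 c2 c3 c4 e)"

lemma terminal_comps_add: "terminal_comps c + of_bool c = 2"
  by (simp add: terminal_comps_def)

text \<open>The components of the bridge graph include those that contain \<open>X\<close> or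
  \<open>Y\<close>; hence no subtraction in \<open>bridge_weight\<close> truncates.\<close>

lemma terminal_comps_bridge_le:
  "of_bool c1 + of_bool c2 + of_bool c3 + of_bool c4 + of_bool e +
     terminal_comps (bridge_joined c1 c2 c3 c4 e) \<le> 4 + bridge_cycles c1 c2 c3 c4 e"
  by (cases c1; cases c2; cases c3; cases c4; cases e)
    (simp_all add: bridge_joined_def bridge_cycles_def terminal_comps_def)

lemma bridge_weight_add:
  "bridge_weight c1 c2 c3 c4 e + of_bool c1 + of_bool c2 + of_bool c3 + of_bool c4 + of_bool e +
     terminal_comps (bridge_joined c1 c2 c3 c4 e) = 4 + 2 * bridge_cycles c1 c2 c3 c4 e"
  using terminal_comps_bridge_le[of c1 c2 c3 c4 e] unfolding bridge_weight_def by linarith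

lemma comps_base:
  "comps 0 {Edge0} = 1" "joined 0 {Edge0}"
proof -
  have adj: "adjacent (subgraph 0 {Edge0}) = {(VX0, VY0), (VY0, VX0)}"
    by (auto simp: adjacent_def doubleton_eq_iff)
  then show "joined 0 {Edge0}"
    by (auto simp: joined_def)
  have "(u, v) \<in> (adjacent (subgraph 0 {Edge0}))\<^sup>*" if "u \<in> {VX0, VY0}" "v \<in> {VX0, VY0}" for u v
    using that unfolding adj by auto
  then show "comps 0 {Edge0} = 1"
    unfolding comps_def by (subst num_components_eq_card_image[of _ "\<lambda>_. ()"]) auto
qed

text \<open>Makes the subtractions in \<open>weight\<close> exact. The induction reuses the
  recursions for components, edges and vertices; the first bound also rests on its analogue for the
  bridge graph.\<close>

lemma comps_bounds:
  assumes "A \<subseteq> edges (fractal_graph n)"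
  shows "terminal_comps (joined n A) \<le> comps n A"
    and "card (verts (fractal_graph n)) \<le> card A + comps n A"
proof -
  have "terminal_comps (joined n A) \<le> comps n A \<and> card (verts (fractal_graph n)) \<le> card A + comps n A"
    using assms
  proof (induction n arbitrary: A)
    case 0
    then have "A = {} \<or> A = {Edge0}" by auto
    then show ?case
      by (auto simp: comps_empty not_joined_empty comps_base terminal_comps_def)
  next
    case (Suc n)
    note part = part_subset[OF Suc.prems]
    have "finite (part i A)" for i
      using part finite_edges finite_subset by metis
    then have card: "card A = of_bool (NewEdge \<in> A) + card (part 1 A) + card (part 2 A)
        + card (part 3 A) + card (part 4 A)"
      using card_glue glue_parts[OF Suc.prems] by metis
    define c where "c = (\<lambda>i. joined n (part i A))"
    have joined: "joined (Suc n) A \<longleftrightarrow> bridge_joined (c 1) (c 2) (c 3) (c 4) (NewEdge \<in> A)"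
      using comps_joined_Suc(1)[OF Suc.prems] by (simp add: c_def)
    have comps: "comps (Suc n) A + 4 + of_bool (NewEdge \<in> A) =
        comps n (part 1 A) + comps n (part 2 A) + comps n (part 3 A) + comps n (part 4 A) +
        bridge_cycles (c 1) (c 2) (c 3) (c 4) (NewEdge \<in> A)"
      using comps_joined_Suc(2)[OF Suc.prems] by (simp add: copies c_def)
    have IH: "terminal_comps (c i) \<le> comps n (part i A)"
      "card (verts (fractal_graph n)) \<le> card (part i A) + comps n (part i A)" for i
      using Suc.IH[OF part] by (auto simp: c_def)
    have "terminal_comps (joined (Suc n) A) \<le> comps (Suc n) A"
      unfolding joined
      using comps terminal_comps_bridge_le[of "c 1" "c 2" "c 3" "c 4" "NewEdge \<in> A"]
        IH(1)[of 1] IH(1)[of 2] IH(1)[of 3] IH(1)[of 4]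
        terminal_comps_add[of "c 1"] terminal_comps_add[of "c 2"]
        terminal_comps_add[of "c 3"] terminal_comps_add[of "c 4"]
      by linarith
    moreover have "card (verts (fractal_graph (Suc n))) \<le> card A + comps (Suc n) A"
      using comps card card_verts_Suc[of n] IH(2)[of 1] IH(2)[of 2] IH(2)[of 3] IH(2)[of 4]
      by linarith
    ultimately show ?case by blast
  qed
  then show "terminal_comps (joined n A) \<le> comps n A"
    "card (verts (fractal_graph n)) \<le> card A + comps n A" by auto
qed

lemma weight_add:
  assumes "A \<subseteq> edges (fractal_graph n)"
  shows "weight n A + terminal_comps (joined n A) + card (verts (fractal_graph n)) =
    2 * comps n A + card A"
  using comps_bounds[OF assms] unfolding weight_def by linarith

text \<open>By \<open>weight_add\<close> the exponent is linear in quantities with known recursions;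
  \<open>terminal_comps_add\<close> turns the terminal components of the parts into the edge states
  that enter \<open>bridge_weight\<close>.\<close>

lemma weight_glue:
  assumes "A1 \<subseteq> edges (fractal_graph n)" "A2 \<subseteq> edges (fractal_graph n)"
    "A3 \<subseteq> edges (fractal_graph n)" "A4 \<subseteq> edges (fractal_graph n)"
  shows "weight (Suc n) (glue A1 A2 A3 A4 e) =
    weight n A1 + weight n A2 + weight n A3 + weight n A4 +
    bridge_weight (joined n A1) (joined n A2) (joined n A3) (joined n A4) e"
proof -
  let ?A = "glue A1 A2 A3 A4 e"
  note sub = glue_subset[OF assms, of e]
  have "card ?A = of_bool e + card A1 + card A2 + card A3 + card A4"
    using assms by (intro card_glue) (auto intro: finite_subset[OF _ finite_edges])
  moreover have "comps (Suc n) ?A + 4 + of_bool e = comps n A1 + comps n A2 + comps n A3 + comps n A4 +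
      bridge_cycles (joined n A1) (joined n A2) (joined n A3) (joined n A4) e"
    using comps_joined_Suc(2)[OF sub] by (simp add: copies part_glue)
  moreover have "joined (Suc n) ?A \<longleftrightarrow>
      bridge_joined (joined n A1) (joined n A2) (joined n A3) (joined n A4) e"
    using comps_joined_Suc(1)[OF sub] by (simp add: part_glue)
  ultimately show ?thesis
    using weight_add[OF sub] assms[THEN weight_add] card_verts_Suc[of n]
      bridge_weight_add[of "joined n A1" "joined n A2" "joined n A3" "joined n A4" e]
      terminal_comps_add[of "joined n A1"] terminal_comps_add[of "joined n A2"]
      terminal_comps_add[of "joined n A3"] terminal_comps_add[of "joined n A4"]
    by (simp only:)
qed

section \<open>Summation over all edge sets\<close>

text \<open>The division is exact because \<open>4 ^ n\<close> leaves remainder 1 modulo 3.\<close>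

lemma exponent_Suc: "(4 ^ Suc n - 1) div 3 = Suc (4 * ((4 ^ n - 1) div 3 :: nat))"
proof -
  have "\<exists>k. 4 ^ n = Suc (3 * k)"
    by (induction n) (auto, presburger)
  then show ?thesis by auto
qed

text \<open>A computation over the 32 edge sets of the bridge graph. That both classes give the same
  polynomial reflects self-duality of the bridge with terminals \<open>X\<close> and
  \<open>Y\<close>: duality exchanges joining and separating sets and swaps the two summands of the
  exponent.\<close>

lemma bridge_sum:
  fixes z :: "'a::comm_ring_1" and h :: "bool \<Rightarrow> 'a"
  defines "g \<equiv> \<lambda>c1 c2 c3 c4. \<Sum>e\<in>UNIV. z ^ bridge_weight c1 c2 c3 c4 e * h (bridge_joined c1 c2 c3 c4 e)"
  shows "(\<Sum>c1\<in>UNIV. \<Sum>c2\<in>UNIV. \<Sum>c3\<in>UNIV. \<Sum>c4\<in>UNIV. g c1 c2 c3 c4) =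
    (z\<^sup>2 + 7 * z + 8) * (h True + h False)"
  unfolding g_def UNIV_bool
  by (simp add: bridge_weight_def bridge_cycles_def bridge_joined_def terminal_comps_def algebra_simps
      power2_eq_square)

text \<open>
  An arbitrary \<open>h\<close> handles both classes at once and is what lets the induction be applied to the four
  copies one after the other.
\<close>

lemma sum_weight:
  fixes z :: "'a::comm_ring_1" and h :: "bool \<Rightarrow> 'a"
  shows "(\<Sum>A\<in>Pow (edges (fractal_graph n)). z ^ weight n A * h (joined n A)) =
    (z\<^sup>2 + 7 * z + 8) ^ ((4 ^ n - 1) div 3) * (\<Sum>c\<in>UNIV. h c)"
proof (induction n arbitrary: h)
  case 0
  have "Pow (edges (fractal_graph 0)) = {{}, {Edge0}}"
    by auto
  then show ?case
    by (simp add: weight_def comps_empty not_joined_empty comps_base terminal_comps_def UNIV_bool)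
next
  case (Suc n)
  let ?P = "Pow (edges (fractal_graph n))"
  let ?w = "weight n" and ?c = "joined n"
  let ?a = "(z\<^sup>2 + 7 * z + 8) ^ ((4 ^ n - 1) div 3)"
  define g where "g = (\<lambda>c1 c2 c3 c4. \<Sum>e\<in>UNIV.
    z ^ bridge_weight c1 c2 c3 c4 e * h (bridge_joined c1 c2 c3 c4 e))"
  have joined: "joined (Suc n) (glue A1 A2 A3 A4 e) \<longleftrightarrow> bridge_joined (?c A1) (?c A2) (?c A3) (?c A4) e"
    if "A1 \<in> ?P" "A2 \<in> ?P" "A3 \<in> ?P" "A4 \<in> ?P" for A1 A2 A3 A4 e
    using comps_joined_Suc(1)[OF glue_subset] that by (simp add: part_glue)
  have "(\<Sum>A\<in>Pow (edges (fractal_graph (Suc n))). z ^ weight (Suc n) A * h (joined (Suc n) A)) =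
    (\<Sum>A1\<in>?P. \<Sum>A2\<in>?P. \<Sum>A3\<in>?P. \<Sum>A4\<in>?P. z ^ ?w A1 * (z ^ ?w A2 * (z ^ ?w A3 * (z ^ ?w A4 *
       g (?c A1) (?c A2) (?c A3) (?c A4)))))"
    unfolding sum_Pow_edges_Suc g_def
    by (intro sum.cong refl) (simp add: weight_glue joined power_add sum_distrib_left mult_ac)
  also have "\<dots> = (\<Sum>A1\<in>?P. z ^ ?w A1 * (\<Sum>A2\<in>?P. z ^ ?w A2 * (\<Sum>A3\<in>?P. z ^ ?w A3 *
      (\<Sum>A4\<in>?P. z ^ ?w A4 * g (?c A1) (?c A2) (?c A3) (?c A4)))))"
    by (simp add: sum_distrib_left)
  \<comment> \<open>The sums are evaluated from the innermost copy outwards; each time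
    \<open>h\<close> is instantiated by the inner sums already evaluated, as a function of one
    state.\<close>
  also have "\<dots> = ?a * (\<Sum>c1\<in>UNIV. ?a * (\<Sum>c2\<in>UNIV. ?a * (\<Sum>c3\<in>UNIV. ?a *
      (\<Sum>c4\<in>UNIV. g c1 c2 c3 c4))))"
    by (simp only: Suc.IH[of "g _ _ _"] Suc.IH[of "\<lambda>c. ?a * (\<Sum>c4\<in>UNIV. g _ _ c c4)"]
        Suc.IH[of "\<lambda>c. ?a * (\<Sum>c3\<in>UNIV. ?a * (\<Sum>c4\<in>UNIV. g _ c c3 c4))"]
        Suc.IH[of "\<lambda>c. ?a * (\<Sum>c2\<in>UNIV. ?a * (\<Sum>c3\<in>UNIV. ?a * (\<Sum>c4\<in>UNIV. g c c2 c3 c4)))"])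
  also have "\<dots> = ?a ^ 4 * (\<Sum>c1\<in>UNIV. \<Sum>c2\<in>UNIV. \<Sum>c3\<in>UNIV. \<Sum>c4\<in>UNIV. g c1 c2 c3 c4)"
    by (simp add: power4_eq_xxxx mult.assoc flip: sum_distrib_left)
  also have "\<dots> = (z\<^sup>2 + 7 * z + 8) ^ ((4 ^ Suc n - 1) div 3) * (\<Sum>c\<in>UNIV. h c)"
    unfolding g_def bridge_sum exponent_Suc
    by (simp add: UNIV_bool power_mult[symmetric] mult_ac add_ac)
  finally show ?case .
qed

section \<open>From the weighted sum to the Tutte polynomial\<close>

text \<open>The full bridge graph has two independent cycles, so the next graph has
  \<open>4 + 2 - 5 = 1\<close> component.\<close>

lemma connected_fractal_graph:
  "joined n (edges (fractal_graph n)) \<and> comps n (edges (fractal_graph n)) = 1"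
proof (induction n)
  case 0
  then show ?case by (simp add: comps_base)
next
  case (Suc n)
  have part: "part i (edges (fractal_graph (Suc n))) = edges (fractal_graph n)" if "i \<in> {1..4}" for i
    using that by (auto intro!: bexI[of _ i])
  have "NewEdge \<in> edges (fractal_graph (Suc n))" by simp
  with Suc comps_joined_Suc[OF subset_refl, of n] show ?case
    by (simp add: part bridge_joined_def bridge_cycles_def del: fractal_graph.simps)
qed

text \<open>Keeps the rank of a spanning subgraph from being truncated.\<close>

lemma comps_le: "comps n A \<le> card (verts (fractal_graph n))"
proof -
  have "comps n A = card ((\<lambda>v. (adjacent (subgraph n A))\<^sup>* `` {v}) ` verts (fractal_graph n))"
    unfolding comps_def using labels_Image[OF sym_adjacent[of "subgraph n A"]]
    by (subst num_components_eq_card_image) (simp_all add: labels_def)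
  then show ?thesis
    by (simp add: card_image_le finite_verts)
qed

lemma spanning_subgraphs_eq: "spanning_subgraphs G = (\<lambda>A. G\<lparr>edges := A\<rparr>) ` Pow (edges G)"
proof -
  have "H \<in> (\<lambda>A. G\<lparr>edges := A\<rparr>) ` Pow (edges G)" if "H \<in> spanning_subgraphs G" for H
    using that by (intro image_eqI[of _ _ "edges H"]) (auto simp: spanning_subgraphs_def)
  then show ?thesis
    by (auto simp: spanning_subgraphs_def)
qed

theorem theorem4:
  fixes n :: nat and x :: "'a::comm_ring_1"
  assumes "n \<ge> 1"
  shows "tutte (fractal_graph n) x x = x * (x\<^sup>2 + 5 * x + 2) ^ ((4 ^ n - 1) div 3)"
proof -
  let ?G = "fractal_graph n"
  \<comment> \<open>Restores the factor \<open>x - 1\<close> that \<open>weight\<close> drops when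
    the special vertices are not joined.\<close>
  let ?h = "\<lambda>c. (x - 1) ^ (terminal_comps c - 1)"
  have exponent: "(graph_rank ?G - graph_rank (subgraph n A)) + graph_nullity (subgraph n A) =
      weight n A + (terminal_comps (joined n A) - 1)" if "A \<subseteq> edges ?G" for A
  proof -
    have "num_components ?G = 1"
      using connected_fractal_graph[of n] by (simp add: comps_def)
    then show ?thesis
      using comps_bounds(1)[OF that] comps_le[of n A]
      by (simp add: graph_rank_def graph_nullity_def weight_def terminal_comps_def flip: comps_def split: if_splits)
  qed
  have "inj (\<lambda>A. ?G\<lparr>edges := A\<rparr>)"
    by (rule inj_on_inverseI[where g = edges]) simp
  then have "tutte ?G x x = (\<Sum>A\<in>Pow (edges ?G).
      (x - 1) ^ (graph_rank ?G - graph_rank (subgraph n A)) * (x - 1) ^ graph_nullity (subgraph n A))"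
    unfolding tutte_def spanning_subgraphs_eq
    by (subst sum.reindex) (auto intro: inj_on_subset)
  also have "\<dots> = (\<Sum>A\<in>Pow (edges ?G). (x - 1) ^ weight n A * ?h (joined n A))"
    by (intro sum.cong refl) (simp add: exponent flip: power_add)
  \<comment> \<open>Over the two states \<open>?h\<close> sums to
    \<open>1 + (x - 1) = x\<close>.\<close>
  also have "\<dots> = ((x - 1)\<^sup>2 + 7 * (x - 1) + 8) ^ ((4 ^ n - 1) div 3) * x"
    using sum_weight[of "x - 1" n ?h] by (simp add: UNIV_bool terminal_comps_def)
  also have "(x - 1)\<^sup>2 + 7 * (x - 1) + 8 = x\<^sup>2 + 5 * x + 2"
    by (simp add: power2_eq_square algebra_simps)
  finally show ?thesis
    by (simp add: mult.commute)
qed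

end
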